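(* Let $d\ge2$, let $\lambda\in\mathbb{R}$ satisfy $2d-4<|\lambda|<2d$, and let $D$ be an open bounded domain in $\mathbb{R}^d$ with $D\cap\mathbb{Z}^d\ne\emptyset$. Let $v:\mathbb{Z}^d\to\mathbb{C}$ satisfy $\operatorname{supp}v\subset D$. Let $\mathcal{N}\subseteq\Gamma(\lambda)\times\mathbb{S}^{d-1}$ be an open nonempty neighbourhood of some fixed pair $(k,\omega)$ with $k\in\Gamma(\lambda)$, $\omega\in\mathbb{S}^{d-1}$. Then the Born-approximation scattering amplitude $A$ of $v$, given at the fixed $\lambda$ on $\mathcal{N}$, uniquely determines $v$. That is, if $v_1,v_2:\mathbb{Z}^d\to\mathbb{C}$ are supported in $D$ and their Born-approximation scattering amplitudes at $\lambda$ satisfy $A_1=A_2$ on $\mathcal{N}$, then $v_1=v_2$.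
   Context: $T^d=\mathbb{R}^d/2\pi\mathbb{Z}^d$, $\phi(k)=2\sum_{i=1}^d\cos k_i$, $\Gamma(\lambda)=\{k\in T^d:\phi(k)=\lambda\}$. For $2d-4<|\lambda|<2d$ the surface $\Gamma(\lambda)$ is smooth and strictly convex with non-zero principal curvatures, and for $\omega\in\mathbb{S}^{d-1}$, $\kappa(\omega,\lambda)$ denotes the unique point of $\Gamma(\lambda)$ with $\nabla\phi(\kappa)/|\nabla\phi(\kappa)|=\omega$. $K(\omega,\lambda)$ is the total curvature (product of principal curvatures) of $\Gamma(\lambda)$ at $\kappa(\omega,\lambda)$, and $\sigma=d-1$. Discrete Fourier transform: $\hat v(p)=(2\pi)^{-d/2}\sum_{x\in\mathbb{Z}^d}v(x)e^{-ip\cdot x}$, $p\in T^d$. The discrete Schrödinger equation is $\Delta\psi+v\psi-\lambda\psi=0$ on $\mathbb{Z}^d$, with $\Delta\psi(x)=\sum_{|x'-x|=1}\psi(x')$. Its scattering amplitude in the Born approximation (for small $v$) is the function $$A(k,\omega)=-\frac{\sqrt{2\pi}\,\hat v\big(\kappa(-\omega,\lambda)-k\big)\,e^{-i(\sigma+2)\pi/4}}{\sqrt{|K(\omega,\lambda)|}\,|\nabla\phi(\kappa(\omega,\lambda))|},\qquad k\in\Gamma(\lambda),\ \omega\in\mathbb{S}^{d-1}.$$ In the statement, $A$ means this function. *)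

theory Defs
  imports "HOL-Analysis.Analysis"
begin

section \<open>The torus\<close>

definition lattice_rel :: "real ^ 'n \<Rightarrow> real ^ 'n \<Rightarrow> bool" where
  "lattice_rel x y \<longleftrightarrow> (\<exists>m :: int ^ 'n. \<forall>i. x $ i = y $ i + 2 * pi * of_int (m $ i))"

lemma equivp_lattice_rel: "equivp lattice_rel"
proof (rule equivpI)
  show "reflp lattice_rel"
    unfolding reflp_def lattice_rel_def by (auto intro!: exI[of _ 0])
  show "symp lattice_rel"
  proof (rule sympI)
    fix x y :: "real ^ 'n" assume "lattice_rel x y"
    then obtain m :: "int ^ 'n" where "\<forall>i. x $ i = y $ i + 2 * pi * of_int (m $ i)"
      unfolding lattice_rel_def by blast
    then show "lattice_rel y x"
      unfolding lattice_rel_def by (intro exI[of _ "- m"]) simp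
  qed
  show "transp lattice_rel"
  proof (rule transpI)
    fix x y z :: "real ^ 'n" assume "lattice_rel x y" "lattice_rel y z"
    then obtain m l :: "int ^ 'n"
      where "\<forall>i. x $ i = y $ i + 2 * pi * of_int (m $ i)"
        and "\<forall>i. y $ i = z $ i + 2 * pi * of_int (l $ i)"
      unfolding lattice_rel_def by blast
    then show "lattice_rel x z"
      unfolding lattice_rel_def by (intro exI[of _ "m + l"]) (simp add: algebra_simps)
  qed
qed

quotient_type 'n torus = "real ^ ('n::finite)" / lattice_rel
  morphisms rep_torus to_torus
  by (rule equivp_lattice_rel)

text \<open>The quotient topology; \<open>to_torus\<close> is the quotient map from Euclidean space.\<close>

instantiation torus :: (finite) topological_space
begin

definition open_torus :: "'a torus set \<Rightarrow> bool" where
  "open_torus U \<longleftrightarrow> open (to_torus -` U)"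

instance
proof
  show "open (UNIV :: 'a torus set)"
    by (simp add: open_torus_def)
  show "open (S \<inter> T)" if "open S" "open T" for S T :: "'a torus set"
    using that by (simp add: open_torus_def vimage_Int open_Int)
  show "open (\<Union> K)" if "\<forall>S\<in>K. open S" for K :: "'a torus set set"
    using that by (auto simp add: open_torus_def vimage_Union)
qed

end

instantiation torus :: (finite) minus
begin

lift_definition minus_torus :: "'a torus \<Rightarrow> 'a torus \<Rightarrow> 'a torus" is "\<lambda>x y. x - y"
proof -
  fix x x' y y' :: "real ^ 'a" assume "lattice_rel x x'" "lattice_rel y y'"
  then obtain m l :: "int ^ 'a"
    where "\<forall>i. x $ i = x' $ i + 2 * pi * of_int (m $ i)"
      and "\<forall>i. y $ i = y' $ i + 2 * pi * of_int (l $ i)"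
    unfolding lattice_rel_def by blast
  then show "lattice_rel (x - y) (x' - y')"
    unfolding lattice_rel_def by (intro exI[of _ "m - l"]) (simp add: algebra_simps)
qed

instance ..

end


section \<open>Curvature of the level sets of a function\<close>

definition grad :: "('a::real_inner \<Rightarrow> real) \<Rightarrow> 'a \<Rightarrow> 'a" where
  "grad f x = (THE D. GDERIV f x :> D)"

definition unit_normal :: "('a::real_inner \<Rightarrow> real) \<Rightarrow> 'a \<Rightarrow> 'a" where
  "unit_normal f x = grad f x /\<^sub>R norm (grad f x)"

definition tangent_space :: "('a::real_inner \<Rightarrow> real) \<Rightarrow> 'a \<Rightarrow> 'a set" where
  "tangent_space f x = {\<xi>. \<xi> \<bullet> grad f x = 0}"

text \<open>
  The Weingarten map of the level set of \<open>f\<close> through \<open>x\<close>, oriented by the gradient: minus the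
  differential of the Gauss map. Here the Gauss map is extended to a neighbourhood of the level
  set; on the tangent space its derivative does not depend on the extension. It is only used on
  \<open>tangent_space f x\<close>, and only where the gradient does not vanish.
\<close>

definition shape_operator :: "('a::real_inner \<Rightarrow> real) \<Rightarrow> 'a \<Rightarrow> 'a \<Rightarrow> 'a" where
  "shape_operator f x \<xi> = - frechet_derivative (unit_normal f) (at x) \<xi>"

definition principal_space :: "('a::real_inner \<Rightarrow> real) \<Rightarrow> 'a \<Rightarrow> real \<Rightarrow> 'a set" where
  "principal_space f x \<mu> = {\<xi> \<in> tangent_space f x. shape_operator f x \<xi> = \<mu> *\<^sub>R \<xi>}"

definition principal_curvatures :: "('a::real_inner \<Rightarrow> real) \<Rightarrow> 'a \<Rightarrow> real set" where
  "principal_curvatures f x = {\<mu>. \<exists>\<xi> \<in> principal_space f x \<mu>. \<xi> \<noteq> 0}"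

text \<open>
  The shape operator is self-adjoint on the tangent space, so the dimension of
  \<open>principal_space f x \<mu>\<close> is the multiplicity of the principal curvature \<open>\<mu>\<close>.
\<close>

definition total_curvature :: "('a::real_inner \<Rightarrow> real) \<Rightarrow> 'a \<Rightarrow> real" where
  "total_curvature f x = (\<Prod>\<mu>\<in>principal_curvatures f x. \<mu> ^ dim (principal_space f x \<mu>))"


section \<open>The dispersion function and its level surfaces\<close>

text \<open>\<open>phi_lift\<close> is the \<open>2\<pi>\<close>-periodic lift to Euclidean space of the function \<open>phi\<close> on the
  torus. Derivatives on the torus are those of the lift.\<close>

definition phi_lift :: "real ^ 'n \<Rightarrow> real" where
  "phi_lift k = 2 * (\<Sum>i\<in>UNIV. cos (k $ i))"

lemma phi_lift_add_lattice:
  "phi_lift (x + (\<chi> i. 2 * pi * of_int (m $ i))) = phi_lift x"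
proof -
  have "cos (a + 2 * pi * of_int n) = cos a" for a :: real and n :: int
    by (simp add: cos_add)
  then show ?thesis
    by (simp add: phi_lift_def)
qed

lemma lattice_rel_eq:
  "lattice_rel x y \<longleftrightarrow> (\<exists>m :: int ^ 'n. x = (y :: real ^ 'n) + (\<chi> i. 2 * pi * of_int (m $ i)))"
  by (simp add: lattice_rel_def vec_eq_iff)

lemma has_derivative_periodic:
  fixes f :: "'a::real_normed_vector \<Rightarrow> 'b::real_normed_vector"
  assumes "\<And>x. f (x + p) = f x"
  shows "(f has_derivative f') (at (x + p)) \<longleftrightarrow> (f has_derivative f') (at x)"
proof
  assume "(f has_derivative f') (at (x + p))"
  moreover have "((\<lambda>x. x + p) has_derivative (\<lambda>h. h)) (at x)"
    by (auto intro!: derivative_eq_intros)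
  ultimately have "((\<lambda>x. f (x + p)) has_derivative f') (at x)"
    by (rule has_derivative_compose[rotated])
  then show "(f has_derivative f') (at x)"
    using assms by simp
next
  assume "(f has_derivative f') (at x)"
  then have "(f has_derivative f') (at (x + p - p))"
    by simp
  moreover have "((\<lambda>x. x - p) has_derivative (\<lambda>h. h)) (at (x + p))"
    by (auto intro!: derivative_eq_intros)
  ultimately have "((\<lambda>x. f (x - p)) has_derivative f') (at (x + p))"
    by (rule has_derivative_compose[rotated])
  moreover have "f (y - p) = f y" for y
    using assms[of "y - p"] by simp
  ultimately show "(f has_derivative f') (at (x + p))"
    by simp
qed

lemma grad_periodic:
  assumes "\<And>x. f (x + p) = f x"
  shows "grad f (x + p) = grad f x"
  unfolding grad_def gderiv_def has_derivative_periodic[of f, OF assms] ..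

lemma total_curvature_periodic:
  assumes "\<And>x. f (x + p) = f x"
  shows "total_curvature f (x + p) = total_curvature f x"
proof -
  have g: "grad f (y + p) = grad f y" for y
    using assms by (rule grad_periodic)
  then have "unit_normal f (y + p) = unit_normal f y" for y
    by (simp add: unit_normal_def)
  then have "frechet_derivative (unit_normal f) (at (x + p)) =
      frechet_derivative (unit_normal f) (at x)"
    unfolding frechet_derivative_def by (subst has_derivative_periodic) auto
  then have "principal_space f (x + p) = principal_space f x"
    by (simp add: fun_eq_iff principal_space_def tangent_space_def shape_operator_def g)
  then show ?thesis
    by (simp add: total_curvature_def principal_curvatures_def)
qed

lemma grad_phi_lift: "grad phi_lift k = (\<chi> i. - 2 * sin (k $ i))"
proof -
  have "GDERIV phi_lift k :> (\<chi> i. - 2 * sin (k $ i))"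
    unfolding gderiv_def phi_lift_def
    by (auto intro!: derivative_eq_intros bounded_linear.has_derivative[OF bounded_linear_vec_nth]
        simp: inner_vec_def sum_distrib_left mult_ac)
  moreover have "D = D'" if "GDERIV phi_lift k :> D" "GDERIV phi_lift k :> D'" for D D'
  proof -
    have "(\<lambda>h. h \<bullet> D) = (\<lambda>h. h \<bullet> D')"
      using that has_derivative_unique unfolding gderiv_def by blast
    then have "(D - D') \<bullet> (D - D') = 0"
      by (metis inner_diff_right right_minus_eq)
    then show ?thesis by simp
  qed
  ultimately show ?thesis
    unfolding grad_def by (intro the_equality) auto
qed

lift_definition phi :: "'n::finite torus \<Rightarrow> real" is phi_lift
  by (auto simp: lattice_rel_eq phi_lift_add_lattice)

lift_definition grad_phi :: "'n::finite torus \<Rightarrow> real ^ 'n" is "grad phi_lift"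
  by (auto simp: lattice_rel_eq intro!: grad_periodic phi_lift_add_lattice)

lift_definition curvature_phi :: "'n::finite torus \<Rightarrow> real" is "total_curvature phi_lift"
  by (auto simp: lattice_rel_eq intro!: total_curvature_periodic phi_lift_add_lattice)

definition level_surface :: "real \<Rightarrow> 'n::finite torus set" where
  "level_surface lam = {k. phi k = lam}"

text \<open>The inverse Gauss map; the point is unique for \<open>2 d - 4 < \<bar>lam\<bar> < 2 d\<close> and \<open>norm \<omega> = 1\<close>.\<close>

definition kappa :: "real ^ 'n \<Rightarrow> real \<Rightarrow> 'n::finite torus" where
  "kappa \<omega> lam = (THE k. k \<in> level_surface lam \<and> grad_phi k /\<^sub>R norm (grad_phi k) = \<omega>)"

definition gauss_curvature :: "real ^ 'n::finite \<Rightarrow> real \<Rightarrow> real" where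
  "gauss_curvature \<omega> lam = curvature_phi (kappa \<omega> lam)"


section \<open>Discrete Fourier transform and Born scattering amplitude\<close>

definition of_lattice :: "int ^ 'n \<Rightarrow> real ^ 'n" where
  "of_lattice x = (\<chi> i. of_int (x $ i))"

lemma exp_lattice_periodic:
  assumes "lattice_rel p q"
  shows "exp (- \<i> * complex_of_real (p \<bullet> of_lattice x)) =
    exp (- \<i> * complex_of_real (q \<bullet> of_lattice x))"
proof -
  obtain m :: "int ^ 'a" where m: "\<And>i. p $ i = q $ i + 2 * pi * of_int (m $ i)"
    using assms unfolding lattice_rel_def by blast
  define n where "n = (\<Sum>i\<in>UNIV. m $ i * x $ i)"
  have "p \<bullet> of_lattice x = q \<bullet> of_lattice x + 2 * pi * of_int n"
    by (simp add: inner_vec_def of_lattice_def m n_def sum_distrib_left sum.distrib[symmetric]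
        algebra_simps)
  then have "- \<i> * complex_of_real (p \<bullet> of_lattice x) =
      - \<i> * complex_of_real (q \<bullet> of_lattice x) + complex_of_real (real_of_int (2 * (- n)) * pi) * \<i>"
    by (simp add: algebra_simps)
  then show ?thesis
    unfolding exp_eq by blast
qed

lift_definition fourier :: "(int ^ 'n \<Rightarrow> complex) \<Rightarrow> 'n::finite torus \<Rightarrow> complex" is
  "\<lambda>v p. complex_of_real ((2 * pi) powr (- real CARD('n) / 2)) *
     (\<Sum>\<^sub>\<infinity>x\<in>UNIV. v x * exp (- \<i> * complex_of_real (p \<bullet> of_lattice x)))"
  by (simp only: exp_lattice_periodic)

text \<open>In the phase factor, \<open>real CARD('n) - 1\<close> is the dimension of the level surface.\<close>

definition born_amplitude ::
  "real \<Rightarrow> (int ^ 'n \<Rightarrow> complex) \<Rightarrow> 'n::finite torus \<Rightarrow> real ^ 'n \<Rightarrow> complex" where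
  "born_amplitude lam v k \<omega> =
     - (complex_of_real (sqrt (2 * pi)) * fourier v (kappa (- \<omega>) lam - k) *
         exp (- \<i> * complex_of_real (((real CARD('n) - 1) + 2) * pi / 4)))
       / complex_of_real (sqrt \<bar>gauss_curvature \<omega> lam\<bar> * norm (grad_phi (kappa \<omega> lam)))"

end

theory Submission imports Defs begin

text \<open>
Write \<open>\<Gamma>\<close> for the level surface. At a point where the denominator of the amplitude is nonzero, \<open>A(k, \<omega>)\<close>
determines the Fourier transform of the potential at \<open>\<kappa>(-\<omega>) - k\<close>. So the difference of two potentials
with the same amplitude gives a trigonometric polynomial \<open>f\<close>, with finitely many frequencies because
\<open>D\<close> is bounded, such that \<open>f (x - y) = 0\<close> for \<open>x\<close> and \<open>y\<close> in certain open pieces of \<open>\<Gamma>\<close>.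

One could now show that the differences \<open>x - y\<close> fill an open set and appeal to analyticity. The
following shorter argument is used instead (\<open>exp_sum_zero_on_differences\<close>). As a function of
\<open>x\<close> alone, \<open>f (x - y)\<close> vanishes on a piece of \<open>\<Gamma>\<close>, so the gradient of \<open>f\<close> at \<open>x - y\<close> is parallel to the normal of
\<open>\<Gamma>\<close> at \<open>x\<close> (\<open>level_surface_multiplier\<close>). By symmetry it is parallel to the normal at \<open>y\<close>. At pairs with
independent normals the gradient is therefore zero, and each partial derivative of \<open>f\<close> has the same
vanishing property as \<open>f\<close>. So all derivatives of \<open>f\<close> vanish at one point; in terms of
coefficients, \<open>\<Sum>z. w z * P z * exp (- \<i> p \<bullet> z) = 0\<close> for every polynomial \<open>P\<close>, and choosing \<open>P\<close> so as to isolate one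
frequency gives \<open>w = 0\<close> (\<open>exp_sum_coeffs_eq_zero\<close>). Pairs with independent normals exist in every open
piece because \<open>\<Gamma>\<close> is curved (\<open>shell_nonparallel\<close>).

The rest is the geometry of \<open>\<Gamma>\<close> for \<open>2 d - 4 < \<bar>lam\<bar> < 2 d\<close>: the inverse Gauss map is well defined
(\<open>shell_gauss_map_inj\<close>, \<open>shell_gauss_map_surj\<close>), and the gradient and the total curvature do not vanish
(\<open>shell_grad_nonzero\<close>, \<open>shell_total_curvature_nonzero\<close>). A point \<open>x\<close> enters these questions only through
the points \<open>(C i, S i) = (\<plusminus> cos (x $ i), sin (x $ i))\<close> of the unit circle, with the sign of \<open>lam\<close>, and the bounds on
\<open>lam\<close> become \<open>d - 2 < (\<Sum>i. C i) < d\<close>. All these claims are then elementary inequalities.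
\<close>


section \<open>Points on circles with a large sum of cosines\<close>

text \<open>All other terms are at most \<open>1\<close>. For cosines on the level surface this means that at most one of
them is negative, and that it has a smaller modulus than all the others.\<close>

lemma pair_sum_pos:
  fixes C :: "'n::finite \<Rightarrow> real"
  assumes le: "\<And>i. C i \<le> 1" and sum: "real CARD('n) - 2 < (\<Sum>i\<in>UNIV. C i)" and "i \<noteq> j"
  shows "0 < C i + C j"
proof -
  have "(\<Sum>l\<in>UNIV. C l) = C i + C j + (\<Sum>l\<in>UNIV - {i, j}. C l)"
    using \<open>i \<noteq> j\<close> by (simp add: sum.subset_diff[of "{i, j}" UNIV])
  moreover have "(\<Sum>l\<in>UNIV - {i, j}. C l) \<le> (\<Sum>l\<in>UNIV - {i, j}. 1)"
    using le by (intro sum_mono) auto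
  moreover have "real (card (UNIV - {i, j})) = real CARD('n) - 2"
  proof -
    have "card {i, j} \<le> CARD('n)" by (rule card_mono) auto
    then show ?thesis using \<open>i \<noteq> j\<close> by (simp add: card_Diff_subset of_nat_diff)
  qed
  ultimately show ?thesis using sum by simp
qed

lemma circle_le_one:
  fixes c s :: real
  assumes "c\<^sup>2 + s\<^sup>2 = 1"
  shows "c \<le> 1"
  using assms by (metis abs_le_D1 abs_square_le_1 le_add_same_cancel1 zero_le_power2)

lemma sum_one_minus_others:
  fixes C :: "'n::finite \<Rightarrow> real"
  shows "(\<Sum>i\<in>UNIV - {j}. 1 - C i) = real CARD('n) - 1 - (\<Sum>i\<in>UNIV. C i) + C j"
proof -
  have "real (card (UNIV - {j})) = real CARD('n) - 1"
    by (simp add: card_Diff_subset of_nat_diff Suc_leI)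
  then show ?thesis
    by (simp add: sum_subtractf sum.remove[of UNIV j C])
qed

lemma sine_nonzero:
  fixes C S :: "'n::finite \<Rightarrow> real"
  assumes circ: "\<And>i. (C i)\<^sup>2 + (S i)\<^sup>2 = 1"
    and lower: "real CARD('n) - 2 < (\<Sum>i\<in>UNIV. C i)" and upper: "(\<Sum>i\<in>UNIV. C i) < real CARD('n)"
  shows "\<exists>i. S i \<noteq> 0"
proof (rule ccontr)
  assume "\<nexists>i. S i \<noteq> 0"
  then have pm: "C i = 1 \<or> C i = -1" for i
    using circ[of i] by (simp add: power2_eq_1_iff)
  obtain j where "C j \<noteq> 1"
    using upper by (metis order_less_irrefl real_of_card sum.cong)
  then have j: "C j = -1" using pm by blast
  have "0 \<le> (\<Sum>i\<in>UNIV - {j}. 1 - C i)"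
    using circle_le_one[OF circ] by (intro sum_nonneg) auto
  then show False
    using lower j by (simp add: sum_one_minus_others)
qed

text \<open>Enlarging the sines by a factor \<open>\<rho> > 1\<close> cannot preserve the sum of the cosines unless it preserves
each of them. If all cosines are nonnegative, each can only decrease. If \<open>C j = - b\<close> is the single negative one, the gain at
\<open>j\<close> beats the losses elsewhere: the change of a cosine is \<open>(\<rho>\<^sup>2 - 1) s\<^sup>2 / (c + c')\<close>, the losses
at \<open>i \<noteq> j\<close> are therefore at most \<open>(\<rho>\<^sup>2 - 1) (1 + b) (1 - C i) / (b + b')\<close>, because
\<open>(1 + c) / (c + c') \<le> (1 + b) / (b + b')\<close> for \<open>c \<ge> b\<close>, \<open>c' \<ge> b'\<close>, and the lower bound on the sum says that
\<open>\<Sum>i\<noteq>j. 1 - C i\<close> is less than \<open>1 - b\<close>.\<close>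

lemma inverse_gauss_unique_aux:
  fixes C S C' S' :: "'n::finite \<Rightarrow> real"
  assumes circ: "\<And>i. (C i)\<^sup>2 + (S i)\<^sup>2 = 1" and circ': "\<And>i. (C' i)\<^sup>2 + (S' i)\<^sup>2 = 1"
    and lower: "real CARD('n) - 2 < (\<Sum>i\<in>UNIV. C i)"
    and eq: "(\<Sum>i\<in>UNIV. C i) = (\<Sum>i\<in>UNIV. C' i)"
    and S': "\<And>i. S' i = \<rho> * S i" and rho: "1 \<le> \<rho>"
  shows "C' = C"
proof -
  have lower': "real CARD('n) - 2 < (\<Sum>i\<in>UNIV. C' i)" using lower eq by simp
  have rho2: "1 \<le> \<rho>\<^sup>2" using rho by simp
  have diff: "(C i)\<^sup>2 - (C' i)\<^sup>2 = (\<rho>\<^sup>2 - 1) * (S i)\<^sup>2" for i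
    using circ[of i] circ'[of i] S'[of i] by (simp add: power_mult_distrib algebra_simps)
  have sq: "(C' i)\<^sup>2 \<le> (C i)\<^sup>2" for i
    using diff[of i] rho2 by (smt (verit) mult_nonneg_nonneg zero_le_power2)
  show ?thesis
  proof (cases "\<forall>i. 0 \<le> C i")
    case True
    have le: "C' i \<le> C i" for i
      using sq[of i] True power2_le_imp_le by blast
    have "(\<Sum>i\<in>UNIV. C i - C' i) = 0" using eq by (simp add: sum_subtractf)
    then have "C i - C' i = 0" for i
      using le by (subst (asm) sum_nonneg_eq_0_iff) auto
    then show ?thesis by (simp add: fun_eq_iff)
  next
    case False
    then obtain j where j: "C j < 0" by (auto simp: not_le)
    define b b' where "b = - C j" and "b' = \<bar>C' j\<bar>"
    have b: "0 < b" "0 \<le> b'" using j by (auto simp: b_def b'_def)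
    have big: "b \<le> C i" "b' \<le> C' i" "0 < C' i" if "i \<noteq> j" for i
    proof -
      have p: "0 < C i + C j" "0 < C' i + C' j"
        using that circle_le_one[OF circ] circle_le_one[OF circ'] lower lower'
        by (auto intro: pair_sum_pos)
      then show "b \<le> C i" by (simp add: b_def)
      have "(C j)\<^sup>2 \<le> (C i)\<^sup>2"
        using p j by (intro power2_le_iff_abs_le[THEN iffD2]) auto
      then have "(S i)\<^sup>2 \<le> (S j)\<^sup>2" using circ[of i] circ[of j] by linarith
      then have "(S' i)\<^sup>2 \<le> (S' j)\<^sup>2"
        by (simp add: S' power_mult_distrib mult_left_mono)
      then have "(C' j)\<^sup>2 \<le> (C' i)\<^sup>2" using circ'[of i] circ'[of j] by linarith
      then have "\<bar>C' j\<bar> \<le> \<bar>C' i\<bar>" by (simp add: abs_le_square_iff)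
      then show "b' \<le> C' i" "0 < C' i" using p by (auto simp: b'_def)
    qed
    show ?thesis
    proof (cases "\<rho> = 1")
      case True
      have "C' i = C i" if "i \<noteq> j" for i
        using diff[of i] big[OF that] b True by (simp add: power2_eq_iff)
      moreover from this have "C' j = C j"
        using eq by (simp add: sum.remove[of UNIV j])
      ultimately show ?thesis by (metis ext)
    next
      case False
      then have rho2: "0 < \<rho>\<^sup>2 - 1" using rho by simp
      have bound: "(C i - C' i) * (b + b') \<le> (\<rho>\<^sup>2 - 1) * (1 + b) * (1 - C i)" if i: "i \<noteq> j" for i
      proof -
        have pos: "0 < C i + C' i" using big[OF i] b by linarith
        have ci: "0 \<le> 1 - C i" using circle_le_one[OF circ] by simp
        have "(1 + C i) * (b + b') \<le> (1 + b) * (C i + C' i)"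
        proof -
          have "b * (1 - b') \<le> C i * (1 - b')"
            using big[OF i] circle_le_one[OF circ', of i] by (intro mult_right_mono) auto
          moreover have "0 \<le> (1 + b) * (C' i - b')" using big[OF i] b by simp
          ultimately show ?thesis by (simp add: algebra_simps)
        qed
        then have "(\<rho>\<^sup>2 - 1) * (1 - C i) * ((1 + C i) * (b + b'))
            \<le> (\<rho>\<^sup>2 - 1) * (1 - C i) * ((1 + b) * (C i + C' i))"
          using rho2 ci by (intro mult_left_mono) auto
        moreover have "(C i - C' i) * (C i + C' i) = (\<rho>\<^sup>2 - 1) * ((1 - C i) * (1 + C i))"
        proof -
          have "(1 - C i) * (1 + C i) = (S i)\<^sup>2"
            using circ[of i] by (simp add: power2_eq_square algebra_simps)
          moreover have "(C i - C' i) * (C i + C' i) = (C i)\<^sup>2 - (C' i)\<^sup>2"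
            by (simp add: power2_eq_square algebra_simps)
          ultimately show ?thesis by (simp only: diff)
        qed
        ultimately have "((C i - C' i) * (b + b')) * (C i + C' i)
            \<le> ((\<rho>\<^sup>2 - 1) * (1 + b) * (1 - C i)) * (C i + C' i)"
          by (smt (verit, best) mult.assoc mult.commute)
        then show ?thesis using pos by simp
      qed
      have "(b - b') * (b + b') \<le> (C' j - C j) * (b + b')"
        using b by (intro mult_right_mono) (auto simp: b_def b'_def)
      also have "C' j - C j = (\<Sum>i\<in>UNIV - {j}. C i - C' i)"
        using eq by (simp add: sum_subtractf sum.remove[of UNIV j])
      also have "\<dots> * (b + b') = (\<Sum>i\<in>UNIV - {j}. (C i - C' i) * (b + b'))"
        by (rule sum_distrib_right)
      also have "\<dots> \<le> (\<Sum>i\<in>UNIV - {j}. (\<rho>\<^sup>2 - 1) * (1 + b) * (1 - C i))"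
        using bound by (intro sum_mono) auto
      also have "\<dots> = (\<rho>\<^sup>2 - 1) * (1 + b) * (\<Sum>i\<in>UNIV - {j}. 1 - C i)"
        by (simp add: sum_distrib_left)
      also have "\<dots> < (\<rho>\<^sup>2 - 1) * (1 + b) * (1 - b)"
        using rho2 b lower by (intro mult_strict_left_mono) (auto simp: sum_one_minus_others b_def)
      also have "\<dots> = (\<rho>\<^sup>2 - 1) * (S j)\<^sup>2"
      proof -
        have "(1 + b) * (1 - b) = (S j)\<^sup>2"
          using circ[of j] by (simp add: b_def power2_eq_square algebra_simps)
        then show ?thesis by (simp only: mult.assoc)
      qed
      also have "\<dots> = (b - b') * (b + b')"
        using diff[of j] by (simp add: b_def b'_def power2_eq_square algebra_simps)
      finally show ?thesis by simp
    qed
  qed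
qed

lemma inverse_gauss_unique:
  fixes C S C' S' :: "'n::finite \<Rightarrow> real"
  assumes circ: "\<And>i. (C i)\<^sup>2 + (S i)\<^sup>2 = 1" and circ': "\<And>i. (C' i)\<^sup>2 + (S' i)\<^sup>2 = 1"
    and lower: "real CARD('n) - 2 < (\<Sum>i\<in>UNIV. C i)" and upper: "(\<Sum>i\<in>UNIV. C i) < real CARD('n)"
    and eq: "(\<Sum>i\<in>UNIV. C i) = (\<Sum>i\<in>UNIV. C' i)"
    and S': "\<And>i. S' i = \<rho> * S i" and rho: "0 < \<rho>"
  shows "C' = C \<and> S' = S"
proof -
  have C: "C' = C"
  proof (cases "1 \<le> \<rho>")
    case True
    then show ?thesis using assms by (intro inverse_gauss_unique_aux[of C S C' S' \<rho>]) auto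
  next
    case False
    then have "C = C'"
      using assms by (intro inverse_gauss_unique_aux[of C' S' C S "1 / \<rho>"]) (auto simp: field_simps)
    then show ?thesis by simp
  qed
  obtain i where i: "S i \<noteq> 0" using sine_nonzero[of C S] circ lower upper by blast
  have "(\<rho> * S i)\<^sup>2 = (S i)\<^sup>2" using circ[of i] circ'[of i] by (simp add: C S')
  then have "\<rho> = 1"
    using i rho by (simp add: power_mult_distrib power2_eq_1_iff)
  then show ?thesis using C S' by auto
qed

text \<open>Starting from \<open>t = 0\<close> with all cosines equal to \<open>1\<close>, the factor \<open>t\<close> is increased until the largest
sine has modulus \<open>1\<close>; from there the corresponding cosine, now \<open>0\<close>, is continued with the
negative sign while \<open>t\<close> goes back to \<open>0\<close>. The sum of the cosines runs continuously from
\<open>d\<close> to \<open>d - 2\<close>, so that it takes the value \<open>L\<close>.\<close>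

lemma inverse_gauss_exists:
  fixes \<omega> :: "'n::finite \<Rightarrow> real"
  assumes nz: "\<exists>i. \<omega> i \<noteq> 0"
    and lower: "real CARD('n) - 2 < L" and upper: "L < real CARD('n)"
  shows "\<exists>t C. 0 < t \<and> (\<forall>i. (C i)\<^sup>2 + (t * \<omega> i)\<^sup>2 = 1) \<and> (\<Sum>i\<in>UNIV. C i) = L"
proof -
  define m where "m = Max (range (\<lambda>i. \<bar>\<omega> i\<bar>))"
  have "m \<in> range (\<lambda>i. \<bar>\<omega> i\<bar>)" unfolding m_def by (rule Max_in) auto
  then obtain j where j: "m = \<bar>\<omega> j\<bar>" by blast
  have m: "\<bar>\<omega> i\<bar> \<le> m" for i unfolding m_def by (rule Max_ge) auto
  have mpos: "0 < m" using nz m by (metis abs_ge_zero abs_le_zero_iff order_less_le order_trans)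
  define h where "h t i = sqrt (1 - (t * \<omega> i)\<^sup>2)" for t i
  have cont: "continuous_on A (\<lambda>t. h t i)" for A i
    unfolding h_def by (intro continuous_intros)
  have circ: "(h t i)\<^sup>2 + (t * \<omega> i)\<^sup>2 = 1" if "0 \<le> t" "t \<le> 1 / m" for t i
  proof -
    have "\<bar>t * \<omega> i\<bar> \<le> 1 / m * m"
      unfolding abs_mult using that m[of i] mpos by (intro mult_mono) auto
    then have "(t * \<omega> i)\<^sup>2 \<le> 1" using mpos by (simp add: abs_square_le_1)
    then show ?thesis by (simp add: h_def)
  qed
  have hj: "h (1 / m) j = 0" using mpos by (simp add: h_def j power_divide)
  have h0: "h 0 i = 1" for i by (simp add: h_def)
  show ?thesis
  proof (cases "(\<Sum>i\<in>UNIV. h (1 / m) i) \<le> L")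
    case True
    have "continuous_on {0..1 / m} (\<lambda>t. \<Sum>i\<in>UNIV. h t i)"
      by (intro continuous_on_sum cont)
    then obtain t where t: "0 \<le> t" "t \<le> 1 / m" "(\<Sum>i\<in>UNIV. h t i) = L"
      using IVT2'[of "\<lambda>t. \<Sum>i\<in>UNIV. h t i" "1 / m" L 0] True upper mpos
      by (auto simp: h0)
    have "t \<noteq> 0" using t upper by (auto simp: h0)
    then show ?thesis using t circ by (intro exI[of _ t] exI[of _ "h t"]) auto
  next
    case False
    define C where "C t i = (if i = j then - h t i else h t i)" for t i
    have C: "(\<Sum>i\<in>UNIV. C t i) = (\<Sum>i\<in>UNIV. h t i) - 2 * h t j" for t
    proof -
      have "(\<Sum>i\<in>UNIV - {j}. C t i) = (\<Sum>i\<in>UNIV - {j}. h t i)"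
        by (intro sum.cong) (auto simp: C_def)
      then show ?thesis by (simp add: sum.remove[of UNIV j] C_def)
    qed
    have "continuous_on {0..1 / m} (\<lambda>t. (\<Sum>i\<in>UNIV. h t i) - 2 * h t j)"
      by (intro continuous_on_sum continuous_intros cont)
    then obtain t where t: "0 \<le> t" "t \<le> 1 / m" "(\<Sum>i\<in>UNIV. h t i) - 2 * h t j = L"
      using IVT'[of "\<lambda>t. (\<Sum>i\<in>UNIV. h t i) - 2 * h t j" 0 L "1 / m"] False lower mpos
      by (auto simp: h0 hj)
    have "t \<noteq> 0" using t lower by (auto simp: h0)
    moreover have "(C t i)\<^sup>2 = (h t i)\<^sup>2" for i by (simp add: C_def)
    ultimately show ?thesis
      using t circ by (intro exI[of _ t] exI[of _ "C t"]) (auto simp: C)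
  qed
qed

text \<open>The hypotheses on \<open>\<xi>\<close> say that the diagonal matrix \<open>C\<close>, up to a factor the Hessian of the
dispersion function, maps the tangent vector \<open>\<xi>\<close> to a multiple of the normal \<open>S\<close>. If \<open>t \<noteq> 0\<close>,
tangency becomes \<open>\<Sum>i. (1 - (C i)\<^sup>2) / C i = 0\<close>. The summands are nonnegative where the cosine is
positive; where it is \<open>- c < 0\<close> the summand \<open>- (1 - c\<^sup>2) / c\<close> outweighs all the others,
each of which is at most \<open>(1 + 1 / c) (1 - C i)\<close>.\<close>

lemma no_asymptotic_direction:
  fixes C S \<xi> :: "'n::finite \<Rightarrow> real"
  assumes circ: "\<And>i. (C i)\<^sup>2 + (S i)\<^sup>2 = 1"
    and lower: "real CARD('n) - 2 < (\<Sum>i\<in>UNIV. C i)" and upper: "(\<Sum>i\<in>UNIV. C i) < real CARD('n)"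
    and tangent: "(\<Sum>i\<in>UNIV. S i * \<xi> i) = 0"
    and parallel: "\<And>i. C i * \<xi> i = t * S i"
  shows "\<xi> i = 0"
proof -
  have pair: "0 < C i + C j" if "i \<noteq> j" for i j
    using that lower circle_le_one[OF circ] by (intro pair_sum_pos) auto
  have "t = 0"
  proof (rule ccontr)
    assume t: "t \<noteq> 0"
    have nz: "C i \<noteq> 0" for i
      using parallel[of i] circ[of i] t by auto
    have "S i * \<xi> i = t * ((1 - (C i)\<^sup>2) / C i)" for i
    proof -
      have "S i * (C i * \<xi> i) = t * (1 - (C i)\<^sup>2)"
        unfolding parallel circ[of i, symmetric] by (simp add: power2_eq_square)
      then show ?thesis using nz[of i] by (simp add: field_simps)
    qed
    then have "t * (\<Sum>i\<in>UNIV. (1 - (C i)\<^sup>2) / C i) = 0"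
      using tangent by (simp add: sum_distrib_left)
    then have zero: "(\<Sum>i\<in>UNIV. (1 - (C i)\<^sup>2) / C i) = 0" using t by simp
    show False
    proof (cases "\<forall>i. 0 < C i")
      case True
      have le: "(C i)\<^sup>2 \<le> 1" for i using circ[of i] by (smt (verit) zero_le_power2)
      have "\<forall>i\<in>UNIV. (1 - (C i)\<^sup>2) / C i = 0"
        using True le zero
        by (subst sum_nonneg_eq_0_iff[symmetric]) (auto intro!: divide_nonneg_pos)
      then have "1 - (C i)\<^sup>2 = 0" for i using nz[of i] by (simp only: divide_eq_0_iff) blast
      then have "S i = 0" for i using circ[of i] by (metis add_diff_cancel_left' power_zero_numeral power2_eq_iff_nonneg zero_eq_power2)
      then show False using sine_nonzero[of C S] circ lower upper by blast
    next
      case False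
      then obtain j where j: "C j < 0" using nz by (metis linorder_neqE_linordered_idom)
      define c where "c = - C j"
      have c: "0 < c" using j by (simp add: c_def)
      have "(1 - (C i)\<^sup>2) / C i \<le> (1 + 1 / c) * (1 - C i)" if "i \<noteq> j" for i
      proof -
        have ci: "c \<le> C i" "C i \<le> 1"
          using pair[OF that] circle_le_one[OF circ] by (auto simp: c_def)
        have "(1 - (C i)\<^sup>2) / C i = (1 + 1 / C i) * (1 - C i)"
          using c ci by (simp add: field_simps power2_eq_square)
        also have "\<dots> \<le> (1 + 1 / c) * (1 - C i)"
          using c ci by (intro mult_right_mono add_left_mono divide_left_mono) auto
        finally show ?thesis .
      qed
      then have "(\<Sum>i\<in>UNIV - {j}. (1 - (C i)\<^sup>2) / C i) \<le> (\<Sum>i\<in>UNIV - {j}. (1 + 1 / c) * (1 - C i))"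
        by (intro sum_mono) auto
      also have "\<dots> = (1 + 1 / c) * (\<Sum>i\<in>UNIV - {j}. 1 - C i)"
        by (simp add: sum_distrib_left)
      also have "\<dots> < (1 + 1 / c) * (1 - c)"
        using c lower by (intro mult_strict_left_mono) (auto simp: sum_one_minus_others c_def add_pos_pos)
      also have "\<dots> = - ((1 - (C j)\<^sup>2) / C j)"
        using c by (simp add: c_def field_simps power2_eq_square)
      finally show False using zero by (simp add: sum.remove[of UNIV j])
    qed
  qed
  then have prod: "C i * \<xi> i = 0" for i using parallel by simp
  show ?thesis
  proof (cases "C i = 0")
    case True
    then have "C j \<noteq> 0" if "j \<noteq> i" for j using pair[OF that] by auto
    then have "\<xi> j = 0" if "j \<noteq> i" for j using prod[of j] that by auto
    then have "S i * \<xi> i = 0"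
      using tangent by (simp add: sum.remove[of UNIV i])
    then show ?thesis using circ[of i] True by auto
  qed (use prod[of i] in auto)
qed


section \<open>The level surface and its Gauss map\<close>

text \<open>
The lift of the level surface to Euclidean space. The set is empty outside the admissible energies,
so that membership carries the bounds on \<open>lam\<close> along.
\<close>

definition shell :: "real \<Rightarrow> (real ^ 'n) set" where
  "shell lam = {x. phi_lift x = lam \<and> 2 * real CARD('n) - 4 < \<bar>lam\<bar> \<and> \<bar>lam\<bar> < 2 * real CARD('n)}"

text \<open>The factor \<open>sgn lam\<close> reduces negative energies to positive ones: it is the translation by
\<open>(\<pi>, \<dots>, \<pi>)\<close> combined with a reflection, and it leaves the sines, that is the gradient, in place.\<close>

lemma shell_circle:
  fixes x :: "real ^ 'n"
  assumes "CARD('n) \<ge> 2" and x: "x \<in> shell lam"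
  shows "(sgn lam * cos (x $ i))\<^sup>2 + (sin (x $ i))\<^sup>2 = 1"
    and "(\<Sum>i\<in>UNIV. sgn lam * cos (x $ i)) = \<bar>lam\<bar> / 2"
    and "real CARD('n) - 2 < (\<Sum>i\<in>UNIV. sgn lam * cos (x $ i))"
    and "(\<Sum>i\<in>UNIV. sgn lam * cos (x $ i)) < real CARD('n)"
proof -
  have lam: "lam \<noteq> 0" using assms by (auto simp: shell_def)
  then have "(sgn lam)\<^sup>2 = 1" by (simp add: sgn_if)
  then show "(sgn lam * cos (x $ i))\<^sup>2 + (sin (x $ i))\<^sup>2 = 1"
    by (simp add: power_mult_distrib)
  have "(\<Sum>i\<in>UNIV. cos (x $ i)) = lam / 2" using x by (simp add: shell_def phi_lift_def)
  then show *: "(\<Sum>i\<in>UNIV. sgn lam * cos (x $ i)) = \<bar>lam\<bar> / 2"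
    by (simp add: sum_distrib_left[symmetric] abs_sgn mult.commute)
  show "real CARD('n) - 2 < (\<Sum>i\<in>UNIV. sgn lam * cos (x $ i))"
    and "(\<Sum>i\<in>UNIV. sgn lam * cos (x $ i)) < real CARD('n)"
    using x by (simp_all add: * shell_def)
qed

lemma grad_phi_lift_nth: "grad phi_lift x $ i = - 2 * sin (x $ i)"
  by (simp add: grad_phi_lift)

lemma shell_sin_nonzero:
  fixes x :: "real ^ 'n"
  assumes "CARD('n) \<ge> 2" and "x \<in> shell lam"
  shows "\<exists>i. sin (x $ i) \<noteq> 0"
  using sine_nonzero[of "\<lambda>i. sgn lam * cos (x $ i)" "\<lambda>i. sin (x $ i)"] shell_circle[OF assms]
  by blast

lemma shell_grad_nonzero:
  fixes x :: "real ^ 'n"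
  assumes "CARD('n) \<ge> 2" and "x \<in> shell lam"
  shows "grad phi_lift x \<noteq> 0"
  using shell_sin_nonzero[OF assms] by (auto simp: vec_eq_iff grad_phi_lift_nth)

lemma lattice_relI:
  assumes "\<And>i. cos (x $ i) = cos (y $ i)" "\<And>i. sin (x $ i) = sin (y $ i)"
  shows "lattice_rel x y"
proof -
  have "\<exists>n::int. x $ i = y $ i + 2 * pi * of_int n" for i
    using sin_cos_eq_iff[of "x $ i" "y $ i"] assms by (auto simp: mult_ac)
  then obtain n :: "'a \<Rightarrow> int" where "\<And>i. x $ i = y $ i + 2 * pi * of_int (n i)" by metis
  then show ?thesis unfolding lattice_rel_def by (intro exI[of _ "\<chi> i. n i"]) simp
qed

lemma shell_gauss_map_inj:
  fixes x y :: "real ^ 'n"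
  assumes card: "CARD('n) \<ge> 2" and x: "x \<in> shell lam" and y: "y \<in> shell lam"
    and eq: "unit_normal phi_lift x = unit_normal phi_lift y"
  shows "lattice_rel x y"
proof -
  have lam: "lam \<noteq> 0" using card x by (auto simp: shell_def)
  define \<rho> where "\<rho> = norm (grad phi_lift y) / norm (grad phi_lift x)"
  have nz: "norm (grad phi_lift x) \<noteq> 0" "norm (grad phi_lift y) \<noteq> 0"
    using shell_grad_nonzero[OF card] x y by auto
  have rho: "0 < \<rho>" using nz by (simp add: \<rho>_def)
  have "grad phi_lift y = norm (grad phi_lift y) *\<^sub>R unit_normal phi_lift y"
    using nz by (simp add: unit_normal_def)
  also have "\<dots> = \<rho> *\<^sub>R grad phi_lift x"
    unfolding eq[symmetric] by (simp add: \<rho>_def unit_normal_def divide_inverse)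
  finally have "grad phi_lift y $ i = \<rho> * grad phi_lift x $ i" for i
    by (metis vector_scaleR_component real_scaleR_def)
  then have S: "sin (y $ i) = \<rho> * sin (x $ i)" for i
    by (simp add: grad_phi_lift_nth)
  have "(\<lambda>i. sgn lam * cos (y $ i)) = (\<lambda>i. sgn lam * cos (x $ i)) \<and> (\<lambda>i. sin (y $ i)) = (\<lambda>i. sin (x $ i))"
    by (rule inverse_gauss_unique[where \<rho> = \<rho>])
      (use S rho shell_circle[OF card x] shell_circle[OF card y] in auto)
  then show ?thesis
    using lam by (intro lattice_relI) (auto simp: fun_eq_iff sgn_if split: if_splits)
qed

lemma kappa_unit_normal:
  fixes x :: "real ^ 'n"
  assumes card: "CARD('n) \<ge> 2" and x: "x \<in> shell lam"
  shows "kappa (unit_normal phi_lift x) lam = to_torus x"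
  unfolding kappa_def
proof (rule the_equality)
  show "to_torus x \<in> level_surface lam \<and>
      grad_phi (to_torus x) /\<^sub>R norm (grad_phi (to_torus x)) = unit_normal phi_lift x"
    using x by (simp add: level_surface_def shell_def phi.abs_eq grad_phi.abs_eq unit_normal_def)
  fix k assume k: "k \<in> level_surface lam \<and>
      grad_phi k /\<^sub>R norm (grad_phi k) = unit_normal phi_lift x"
  obtain y where y: "k = to_torus y" by (metis Quotient_abs_rep Quotient_torus)
  then have "y \<in> shell lam" "unit_normal phi_lift y = unit_normal phi_lift x"
    using k x by (auto simp: level_surface_def shell_def phi.abs_eq grad_phi.abs_eq unit_normal_def)
  then show "k = to_torus x"
    using shell_gauss_map_inj[OF card _ x, of y] y by (simp add: torus.abs_eq_iff)
qed

lemma unit_normal_uminus: "unit_normal phi_lift (- x) = - unit_normal phi_lift x"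
proof -
  have "grad phi_lift (- x) = - grad phi_lift x" by (simp add: vec_eq_iff grad_phi_lift_nth)
  then show ?thesis by (simp add: unit_normal_def)
qed

lemma shell_uminus: "x \<in> shell lam \<Longrightarrow> - x \<in> shell lam"
  by (simp add: shell_def phi_lift_def)

lemma shell_gauss_map_surj:
  fixes \<omega> :: "real ^ 'n"
  assumes card: "CARD('n) \<ge> 2"
    and lam: "2 * real CARD('n) - 4 < \<bar>lam\<bar>" "\<bar>lam\<bar> < 2 * real CARD('n)" and \<omega>: "norm \<omega> = 1"
  obtains x where "x \<in> shell lam" "unit_normal phi_lift x = \<omega>"
proof -
  have "\<exists>i. \<omega> $ i \<noteq> 0" using \<omega> by (metis norm_zero vec_eq_iff zero_index zero_neq_one)
  then obtain t C where t: "0 < t" and C: "\<And>i. (C i)\<^sup>2 + (t * \<omega> $ i)\<^sup>2 = 1"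
      and sumC: "(\<Sum>i\<in>UNIV. C i) = \<bar>lam\<bar> / 2"
    using inverse_gauss_exists[of "\<lambda>i. \<omega> $ i" "\<bar>lam\<bar> / 2"] lam by auto
  have lam0: "lam \<noteq> 0" using card lam by auto
  have "(sgn lam * C i)\<^sup>2 + (- t * \<omega> $ i)\<^sup>2 = 1" for i
    using C[of i] lam0 by (simp add: power_mult_distrib sgn_if)
  then have "\<exists>a. sgn lam * C i = cos a \<and> - t * \<omega> $ i = sin a" for i
    using sincos_total_2pi by metis
  then obtain a where a: "\<And>i. cos (a i) = sgn lam * C i" "\<And>i. sin (a i) = - t * \<omega> $ i"
    by metis
  define x :: "real ^ 'n" where "x = (\<chi> i. a i)"
  have "phi_lift x = lam"
    using sumC lam0
    by (cases "0 < lam") (simp_all add: phi_lift_def x_def a sum_distrib_left[symmetric] sgn_if sum_negf)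
  then have "x \<in> shell lam" using lam by (simp add: shell_def)
  moreover have "grad phi_lift x = (2 * t) *\<^sub>R \<omega>"
    by (simp add: vec_eq_iff grad_phi_lift_nth x_def a)
  then have "unit_normal phi_lift x = \<omega>" using t \<omega> by (simp add: unit_normal_def)
  ultimately show ?thesis by (rule that)
qed

lemma has_derivative_grad_phi_lift:
  "(grad phi_lift has_derivative (\<lambda>\<xi>. \<chi> i. - 2 * cos (x $ i) * \<xi> $ i)) (at x)"
proof -
  have "((\<lambda>y. \<chi> i. - 2 * sin (y $ i)) has_derivative (\<lambda>\<xi>. \<chi> i. - 2 * cos (x $ i) * \<xi> $ i)) (at x)"
    by (subst has_derivative_componentwise_within)
      (auto simp: Basis_vec_def inner_axis intro!: derivative_eq_intros
        bounded_linear.has_derivative[OF bounded_linear_vec_nth])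
  then show ?thesis by (simp add: grad_phi_lift[abs_def])
qed

text \<open>By the quotient rule the differential of the Gauss map is, up to a nonzero factor, the Hessian
modulo the normal direction, so that a vanishing principal curvature would give a tangent
vector that the Hessian maps into the normal line.\<close>

lemma shell_total_curvature_nonzero:
  fixes x :: "real ^ 'n"
  assumes card: "CARD('n) \<ge> 2" and x: "x \<in> shell lam"
  shows "total_curvature phi_lift x \<noteq> 0"
proof -
  let ?g = "grad phi_lift"
  have g0: "?g x \<noteq> 0" using card x by (rule shell_grad_nonzero)
  have "(\<lambda>y. inverse (norm (?g y))) differentiable (at x)"
  proof -
    have "((\<lambda>y. norm (?g y)) has_derivative (\<lambda>h. ?g x \<bullet> (\<chi> i. - 2 * cos (x $ i) * h $ i) / norm (?g x))) (at x)"
      using has_derivative_compose[OF has_derivative_grad_phi_lift has_derivative_norm[OF g0]]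
      by (simp add: sgn_div_norm inner_commute divide_inverse mult.commute)
    then have "(\<lambda>y. norm (?g y)) differentiable (at x)" by (auto simp: differentiable_def)
    then show ?thesis using g0 by (intro differentiable_inverse) auto
  qed
  then obtain M where M: "((\<lambda>y. inverse (norm (?g y))) has_derivative M) (at x)"
    by (auto simp: differentiable_def)
  have U: "(unit_normal phi_lift has_derivative
      (\<lambda>\<xi>. inverse (norm (?g x)) *\<^sub>R (\<chi> i. - 2 * cos (x $ i) * \<xi> $ i) + M \<xi> *\<^sub>R ?g x)) (at x)"
    unfolding unit_normal_def[abs_def]
    by (rule has_derivative_scaleR[OF M has_derivative_grad_phi_lift])
  have shape: "shape_operator phi_lift x \<xi> =
      - (inverse (norm (?g x)) *\<^sub>R (\<chi> i. - 2 * cos (x $ i) * \<xi> $ i) + M \<xi> *\<^sub>R ?g x)" for \<xi>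
    unfolding shape_operator_def frechet_derivative_at[OF U, symmetric] ..
  have "0 \<notin> principal_curvatures phi_lift x"
  proof
    assume "0 \<in> principal_curvatures phi_lift x"
    then obtain \<xi> where nz: "\<xi> \<noteq> 0" and tangent: "\<xi> \<bullet> ?g x = 0" and zero: "shape_operator phi_lift x \<xi> = 0"
      by (auto simp: principal_curvatures_def principal_space_def tangent_space_def)
    have "\<xi> $ i = 0" for i
    proof (rule no_asymptotic_direction[where t = "- sgn lam * norm (?g x) * M \<xi>" and \<xi> = "\<lambda>i. \<xi> $ i"])
      show "(\<Sum>i\<in>UNIV. sin (x $ i) * \<xi> $ i) = 0"
      proof -
        have "\<xi> \<bullet> ?g x = - 2 * (\<Sum>i\<in>UNIV. sin (x $ i) * \<xi> $ i)"
          unfolding inner_vec_def sum_distrib_left by (intro sum.cong) (simp_all add: grad_phi_lift_nth)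
        then show ?thesis using tangent by simp
      qed
      fix i
      have "inverse (norm (?g x)) *\<^sub>R (\<chi> i. - 2 * cos (x $ i) * \<xi> $ i) + M \<xi> *\<^sub>R ?g x = 0"
        using zero unfolding shape by (simp only: neg_equal_0_iff_equal)
      then have "(inverse (norm (?g x)) *\<^sub>R (\<chi> i. - 2 * cos (x $ i) * \<xi> $ i) + M \<xi> *\<^sub>R ?g x) $ i = 0"
        by (simp only: zero_index)
      then have "inverse (norm (?g x)) * (- 2 * cos (x $ i) * \<xi> $ i) + M \<xi> * (- 2 * sin (x $ i)) = 0"
        by (simp only: vector_add_component vector_scaleR_component vec_lambda_beta real_scaleR_def
            grad_phi_lift_nth)
      then have "norm (?g x) * (inverse (norm (?g x)) * (- 2 * cos (x $ i) * \<xi> $ i)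
          + M \<xi> * (- 2 * sin (x $ i))) = 0"
        by (simp only: mult_zero_right)
      moreover have "norm (?g x) * (inverse (norm (?g x)) * (- 2 * cos (x $ i) * \<xi> $ i)) = - 2 * cos (x $ i) * \<xi> $ i"
        using g0 by simp
      ultimately have "cos (x $ i) * \<xi> $ i = - norm (?g x) * M \<xi> * sin (x $ i)"
        by (simp only: distrib_left)
      then show "sgn lam * cos (x $ i) * \<xi> $ i = - sgn lam * norm (?g x) * M \<xi> * sin (x $ i)"
        by (simp add: mult.assoc)
    qed (use shell_circle[OF card x] in auto)
    then show False using nz by (simp add: vec_eq_iff)
  qed
  then show ?thesis
    \<comment> \<open>Over an infinite index set the product is \<open>1\<close> by convention.\<close>
    unfolding total_curvature_def by (cases "finite (principal_curvatures phi_lift x)") auto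
qed


section \<open>Functions vanishing on the level surface\<close>

text \<open>The branch of the arcus cosine through \<open>a\<close>. It makes curves in the level surface explicit, with no
appeal to the implicit function theorem.\<close>

lemma cos_local_inverse:
  fixes a :: real
  assumes "sin a \<noteq> 0"
  shows "\<exists>G. G (cos a) = a \<and> (G has_real_derivative - inverse (sin a)) (at (cos a)) \<and>
    (\<forall>u. -1 \<le> u \<longrightarrow> u \<le> 1 \<longrightarrow> cos (G u) = u)"
proof -
  define \<theta> where "\<theta> = arccos (cos a)"
  define G where "G = (\<lambda>u. a + sgn (sin a) * (arccos u - \<theta>))"
  have "(sin a)\<^sup>2 > 0" using assms by simp
  then have "(cos a)\<^sup>2 < 1" by (simp add: cos_squared_eq)
  then have lt: "-1 < cos a" "cos a < 1" by (auto simp: abs_square_less_1 abs_less_iff)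
  have cth: "cos \<theta> = cos a" by (simp add: \<theta>_def)
  have sth: "sin \<theta> = \<bar>sin a\<bar>"
    using lt by (simp add: \<theta>_def sin_arccos cos_squared_eq flip: sin_squared_eq)
  have 1: "G (cos a) = a" by (simp add: G_def \<theta>_def)
  have "(G has_real_derivative sgn (sin a) * inverse (- sqrt (1 - (cos a)\<^sup>2))) (at (cos a))"
    unfolding G_def using lt by (auto intro!: derivative_eq_intros)
  moreover have "sgn (sin a) * inverse (- sqrt (1 - (cos a)\<^sup>2)) = - inverse (sin a)"
    using assms by (simp add: cos_squared_eq sgn_if)
  ultimately have 2: "(G has_real_derivative - inverse (sin a)) (at (cos a))" by simp
  have "cos (G u) = u" if u: "-1 \<le> u" "u \<le> 1" for u
  proof -
    define \<delta> where "\<delta> = arccos u - \<theta>"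
    have "cos (G u) = cos (\<theta> + \<delta>)"
      using assms sth cth unfolding G_def \<delta>_def[symmetric]
      by (cases "0 < sin a") (simp_all add: cos_add cos_diff)
    then have "cos (G u) = cos (arccos u)" by (simp add: \<delta>_def)
    then show ?thesis using u by (simp add: cos_arccos)
  qed
  with 1 2 show ?thesis by blast
qed

text \<open>Changing the coordinates \<open>i\<close> and \<open>j\<close> only, and compensating a shift of the former by the latter,
gives a curve in the level surface, on which \<open>g\<close> vanishes identically.\<close>

lemma level_surface_multiplier_aux:
  fixes g :: "real ^ 'n \<Rightarrow> 'b::real_normed_vector"
  assumes der: "(g has_derivative g') (at x)"
    and zero: "\<forall>\<^sub>F y in nhds x. phi_lift y = phi_lift x \<longrightarrow> g y = 0"
    and sj: "sin (x $ j) \<noteq> 0" and ij: "i \<noteq> j"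
  shows "sin (x $ i) *\<^sub>R g' (axis j 1) = sin (x $ j) *\<^sub>R g' (axis i 1)"
proof -
  obtain G where G: "G (cos (x $ j)) = x $ j"
      "(G has_real_derivative - inverse (sin (x $ j))) (at (cos (x $ j)))"
      "\<And>u. -1 \<le> u \<Longrightarrow> u \<le> 1 \<Longrightarrow> cos (G u) = u"
    using cos_local_inverse[OF sj] by blast
  define u where "u s = cos (x $ j) + cos (x $ i) - cos (x $ i + s)" for s
  define c where "c s = x + s *\<^sub>R axis i 1 + (G (u s) - x $ j) *\<^sub>R axis j (1::real)" for s
  have u0: "u 0 = cos (x $ j)" by (simp add: u_def)
  have c0: "c 0 = x" by (simp add: c_def u0 G)
  have du: "(u has_real_derivative sin (x $ i)) (at 0)"
    unfolding u_def by (auto intro!: derivative_eq_intros)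
  have dG: "((\<lambda>s. G (u s)) has_real_derivative - inverse (sin (x $ j)) * sin (x $ i)) (at 0)"
    by (rule DERIV_chain2[OF G(2)[folded u0] du])
  define r where "r = sin (x $ i) / sin (x $ j)"
  have dc: "(c has_vector_derivative (axis i 1 - r *\<^sub>R axis j 1)) (at 0)"
  proof -
    have "((\<lambda>s. (G (u s) - x $ j) *\<^sub>R axis j (1::real)) has_vector_derivative - r *\<^sub>R axis j 1) (at 0)"
      using has_vector_derivative_scaleR[OF DERIV_diff[OF dG DERIV_const] has_vector_derivative_const]
      by (simp add: r_def divide_inverse mult.commute)
    moreover have "((\<lambda>s. x + s *\<^sub>R axis i (1::real)) has_vector_derivative axis i 1) (at 0)"
      by (auto intro!: derivative_eq_intros)
    ultimately show ?thesis
      unfolding c_def by (auto dest: has_vector_derivative_add)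
  qed
  have "((\<lambda>s. g (c s)) has_vector_derivative g' (axis i 1 - r *\<^sub>R axis j 1)) (at 0)"
    using vector_derivative_diff_chain_within[OF dc, of g g'] der
    by (simp add: c0 o_def has_derivative_at_withinI)
  moreover have "((\<lambda>s. g (c s)) has_vector_derivative 0) (at 0)"
  proof -
    have "isCont c 0" using dc by (rule has_vector_derivative_continuous)
    then have tc: "(c \<longlongrightarrow> x) (nhds 0)"
      using tendsto_at_iff_tendsto_nhds[of c 0] by (simp add: isCont_def c0)
    have "isCont u 0" using du by (rule DERIV_isCont)
    then have tu: "(u \<longlongrightarrow> cos (x $ j)) (nhds 0)"
      using tendsto_at_iff_tendsto_nhds[of u 0] by (simp add: isCont_def u0)
    have "(sin (x $ j))\<^sup>2 > 0" using sj by simp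
    then have "(cos (x $ j))\<^sup>2 < 1" by (simp add: cos_squared_eq)
    then have lt: "-1 < cos (x $ j)" "cos (x $ j) < 1" by (auto simp: abs_square_less_1 abs_less_iff)
    have "\<forall>\<^sub>F s in nhds 0. g (c s) = 0"
      using filterlim_iff[THEN iffD1, OF tc, rule_format, OF zero]
        order_tendstoD(1)[OF tu lt(1)] order_tendstoD(2)[OF tu lt(2)]
    proof eventually_elim
      case (elim s)
      have "(\<Sum>k\<in>UNIV. cos (c s $ k) - cos (x $ k)) = (\<Sum>k\<in>{i, j}. cos (c s $ k) - cos (x $ k))"
        by (rule sum.mono_neutral_right) (auto simp: c_def axis_def)
      also have "\<dots> = 0"
        using ij elim G(3)[of "u s"] by (simp add: c_def axis_def) (simp add: u_def)
      finally have "phi_lift (c s) = phi_lift x" by (simp add: phi_lift_def sum_subtractf)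
      then show ?case using elim by simp
    qed
    then have "((\<lambda>s. g (c s)) has_vector_derivative 0) (at 0) \<longleftrightarrow> ((\<lambda>s. 0::'b) has_vector_derivative 0) (at (0::real))"
      by (intro has_vector_derivative_cong_ev) (auto simp: eventually_mono dest: eventually_nhds_x_imp_x)
    then show ?thesis by simp
  qed
  ultimately have "g' (axis i 1 - r *\<^sub>R axis j 1) = 0"
    using vector_derivative_unique_at by blast
  moreover have "linear g'" using der by (rule has_derivative_linear)
  ultimately have "g' (axis i 1) = r *\<^sub>R g' (axis j 1)"
    by (simp add: linear_diff linear_scale)
  then show ?thesis using sj by (simp add: r_def)
qed

text \<open>Lagrange multipliers: a function that vanishes on the level surface has a gradient parallel to the
normal \<open>\<chi> i. sin (x $ i)\<close>.\<close>

lemma level_surface_multiplier: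
  fixes g :: "real ^ 'n \<Rightarrow> 'b::real_normed_vector"
  assumes der: "(g has_derivative g') (at x)"
    and zero: "\<forall>\<^sub>F y in nhds x. phi_lift y = phi_lift x \<longrightarrow> g y = 0"
  shows "sin (x $ i) *\<^sub>R g' (axis j 1) = sin (x $ j) *\<^sub>R g' (axis i 1)"
proof (cases "i = j \<or> sin (x $ i) = 0 \<and> sin (x $ j) = 0")
  case False
  then show ?thesis
    using level_surface_multiplier_aux[OF assms, of j i] level_surface_multiplier_aux[OF assms, of i j]
    by (cases "sin (x $ j) = 0") auto
qed auto


text \<open>Normals that are parallel to a fixed vector on a whole neighbourhood would make the second
fundamental form of the section in the coordinates \<open>i\<close>, \<open>j\<close> vanish at \<open>y\<close>, that is
\<open>(sin y\<^sub>j)\<^sup>2 cos y\<^sub>i + (sin y\<^sub>i)\<^sup>2 cos y\<^sub>j = 0\<close>. This expression factors as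
\<open>(cos y\<^sub>i + cos y\<^sub>j) (1 - cos y\<^sub>i cos y\<^sub>j)\<close>, where neither factor is zero
if \<open>sin y\<^sub>j \<noteq> 0\<close>.\<close>

lemma shell_nonparallel:
  fixes x y :: "real ^ 'n"
  assumes card: "CARD('n) \<ge> 2" and x: "x \<in> shell lam" and y: "y \<in> shell lam"
    and B: "open B" "y \<in> B"
  shows "\<exists>y'\<in>shell lam \<inter> B. \<exists>k l. sin (x $ k) * sin (y' $ l) \<noteq> sin (x $ l) * sin (y' $ k)"
proof (rule ccontr)
  assume "\<not> ?thesis"
  then have par: "sin (x $ k) * sin (y' $ l) = sin (x $ l) * sin (y' $ k)"
    if "y' \<in> shell lam" "y' \<in> B" for y' k l using that by blast
  obtain j where j: "sin (y $ j) \<noteq> 0" using shell_sin_nonzero[OF card y] by blast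
  obtain m where m: "sin (x $ m) \<noteq> 0" using shell_sin_nonzero[OF card x] by blast
  have xj: "sin (x $ j) \<noteq> 0" using par[OF y B(2), of m j] j m by auto
  obtain i where ij: "i \<noteq> j"
  proof -
    have "UNIV \<noteq> {j}"
    proof
      assume "UNIV = {j}"
      then have "CARD('n) = 1" by (metis card_1_singleton_iff One_nat_def)
      then show False using card by simp
    qed
    then show ?thesis using that by blast
  qed
  define g where "g = (\<lambda>z :: real ^ 'n. sin (x $ j) * sin (z $ i) - sin (x $ i) * sin (z $ j))"
  have "(g has_derivative (\<lambda>h. sin (x $ j) * (cos (y $ i) * h $ i) - sin (x $ i) * (cos (y $ j) * h $ j))) (at y)"
    unfolding g_def
    by (auto intro!: derivative_eq_intros bounded_linear.has_derivative[OF bounded_linear_vec_nth])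
  moreover have "\<forall>\<^sub>F z in nhds y. phi_lift z = phi_lift y \<longrightarrow> g z = 0"
    using eventually_nhds_in_open[OF B]
  proof eventually_elim
    case (elim z)
    then show ?case using y par[of z j i] by (auto simp: shell_def g_def)
  qed
  ultimately have "sin (y $ i) *\<^sub>R (sin (x $ j) * (cos (y $ i) * axis j 1 $ i) - sin (x $ i) * (cos (y $ j) * axis j 1 $ j))
      = sin (y $ j) *\<^sub>R (sin (x $ j) * (cos (y $ i) * axis i 1 $ i) - sin (x $ i) * (cos (y $ j) * axis i 1 $ j))"
    by (rule level_surface_multiplier)
  then have "sin (y $ j) * (sin (x $ j) * cos (y $ i)) + sin (y $ i) * (sin (x $ i) * cos (y $ j)) = 0"
    using ij by (simp add: axis_def)
  then have "sin (y $ j) * (sin (y $ j) * (sin (x $ j) * cos (y $ i))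
      + sin (y $ i) * (sin (x $ i) * cos (y $ j))) = 0" by simp
  then have "(sin (y $ j))\<^sup>2 * sin (x $ j) * cos (y $ i)
      + sin (y $ i) * cos (y $ j) * (sin (x $ i) * sin (y $ j)) = 0"
    by (simp add: power2_eq_square algebra_simps)
  then have "sin (x $ j) * ((sin (y $ j))\<^sup>2 * cos (y $ i) + (sin (y $ i))\<^sup>2 * cos (y $ j)) = 0"
    unfolding par[OF y B(2), of i j] by (simp add: power2_eq_square algebra_simps)
  then have "(sin (y $ j))\<^sup>2 * cos (y $ i) + (sin (y $ i))\<^sup>2 * cos (y $ j) = 0"
    using xj by simp
  moreover have "(cos (y $ i) + cos (y $ j)) * (1 - cos (y $ i) * cos (y $ j))
      = (sin (y $ j))\<^sup>2 * cos (y $ i) + (sin (y $ i))\<^sup>2 * cos (y $ j)"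
    unfolding sin_squared_eq by (simp add: power2_eq_square algebra_simps)
  ultimately have "(cos (y $ i) + cos (y $ j)) * (1 - cos (y $ i) * cos (y $ j)) = 0"
    by simp
  moreover have "cos (y $ i) + cos (y $ j) \<noteq> 0"
  proof -
    have "0 < sgn lam * cos (y $ i) + sgn lam * cos (y $ j)"
      using shell_circle[OF card y] ij
      by (intro pair_sum_pos[of "\<lambda>i. sgn lam * cos (y $ i)"]) (auto intro: circle_le_one)
    then show ?thesis by (metis distrib_left less_irrefl mult_zero_right)
  qed
  moreover have "cos (y $ i) * cos (y $ j) \<noteq> 1"
  proof
    assume *: "cos (y $ i) * cos (y $ j) = 1"
    have "(sin (y $ j))\<^sup>2 > 0" using j by simp
    then have "(cos (y $ j))\<^sup>2 < 1" by (simp add: cos_squared_eq)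
    then have "\<bar>cos (y $ j)\<bar> < 1" by (simp add: abs_square_less_1)
    moreover have "\<bar>cos (y $ i)\<bar> * \<bar>cos (y $ j)\<bar> \<le> 1 * \<bar>cos (y $ j)\<bar>"
      by (intro mult_right_mono) auto
    ultimately show False using * by (simp flip: abs_mult)
  qed
  ultimately show False by simp
qed


section \<open>Exponential sums vanishing on differences\<close>

definition exp_sum :: "(int ^ 'n) set \<Rightarrow> (int ^ 'n \<Rightarrow> complex) \<Rightarrow> real ^ 'n \<Rightarrow> complex" where
  "exp_sum X w p = (\<Sum>z\<in>X. w z * exp (- \<i> * complex_of_real (p \<bullet> of_lattice z)))"

lemma exp_sum_has_derivative:
  assumes "finite X"
  shows "(exp_sum X w has_derivative
    (\<lambda>h. exp_sum X (\<lambda>z. - \<i> * complex_of_real (h \<bullet> of_lattice z) * w z) p)) (at p)"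
proof -
  have "((\<lambda>p. w z * exp (- \<i> * complex_of_real (p \<bullet> of_lattice z))) has_derivative
      (\<lambda>h. - \<i> * complex_of_real (h \<bullet> of_lattice z) * w z * exp (- \<i> * complex_of_real (p \<bullet> of_lattice z)))) (at p)"
    for z
  proof -
    have 1: "((\<lambda>p. - \<i> * complex_of_real (p \<bullet> of_lattice z)) has_derivative
        (\<lambda>h. - \<i> * complex_of_real (h \<bullet> of_lattice z))) (at p)"
      by (auto intro!: derivative_eq_intros)
    have 2: "(exp has_derivative (\<lambda>h. exp (- \<i> * complex_of_real (p \<bullet> of_lattice z)) * h))
        (at (- \<i> * complex_of_real (p \<bullet> of_lattice z)))"
      using DERIV_exp has_field_derivative_def by blast
    show ?thesis
      by (rule has_derivative_eq_rhs[OF has_derivative_mult_right[OF has_derivative_compose[OF 1 2]]])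
        (auto simp: fun_eq_iff)
  qed
  then show ?thesis
    unfolding exp_sum_def by (intro has_derivative_sum) auto
qed

lemma axis_inner_of_lattice: "axis j (1::real) \<bullet> of_lattice z = of_int (z $ j)"
  by (simp add: inner_axis' of_lattice_def)

lemma exp_sum_scale: "exp_sum X (\<lambda>z. a * w z) p = a * exp_sum X w p"
  by (simp add: exp_sum_def sum_distrib_left mult_ac)

lemma exp_sum_diff: "exp_sum X (\<lambda>z. w z - w' z) p = exp_sum X w p - exp_sum X w' p"
  by (simp add: exp_sum_def sum_subtractf left_diff_distrib)

text \<open>Multiplying by \<open>z $ j - y $ j\<close> removes the frequency \<open>y\<close> and keeps those that differ from it in
coordinate \<open>j\<close>. Repetition isolates a single exponential, which has no zeros.\<close>

lemma exp_sum_coeffs_eq_zero: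
  assumes fin: "finite X"
    and zero: "\<And>w. P w \<Longrightarrow> exp_sum X w p = 0"
    and closed: "\<And>w j c. P w \<Longrightarrow> P (\<lambda>z. of_int (z $ j - c) * w z)"
    and "P w" "z \<in> X"
  shows "w z = 0"
  using assms(4,5)
proof (induction "card {z\<in>X. w z \<noteq> 0}" arbitrary: w z rule: less_induct)
  case less
  show ?case
  proof (rule ccontr)
    assume nz: "w z \<noteq> 0"
    show False
    proof (cases "\<exists>y\<in>X. y \<noteq> z \<and> w y \<noteq> 0")
      case True
      then obtain y where y: "y \<in> X" "y \<noteq> z" "w y \<noteq> 0" by blast
      then obtain j where j: "z $ j \<noteq> y $ j" by (metis vec_eq_iff)
      let ?w = "\<lambda>x. of_int (x $ j - y $ j) * w x"
      have "card {x\<in>X. ?w x \<noteq> 0} < card {x\<in>X. w x \<noteq> 0}"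
        using fin y by (intro psubset_card_mono) auto
      then have "?w z = 0"
        by (rule less.hyps[of ?w z, OF _ closed[OF less.prems(1), of j "y $ j"] less.prems(2)])
      then show False using nz j by simp
    next
      case False
      have "exp_sum X w p = (\<Sum>x\<in>{z}. w x * exp (- \<i> * complex_of_real (p \<bullet> of_lattice x)))"
        unfolding exp_sum_def using fin False less.prems by (intro sum.mono_neutral_right) auto
      then show False using zero[OF less.prems(1)] nz by simp
    qed
  qed
qed

lemma parallel_to_independent_imp_zero:
  fixes a :: "'n \<Rightarrow> complex" and s t :: "'n \<Rightarrow> real"
  assumes s: "\<And>i j. s i *\<^sub>R a j = s j *\<^sub>R a i" and t: "\<And>i j. t i *\<^sub>R a j = t j *\<^sub>R a i"
    and indep: "s k * t l \<noteq> s l * t k"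
  shows "a i = 0"
proof -
  have l: "(s k * t l - s l * t k) *\<^sub>R a l = 0"
    using arg_cong[OF s[of k l], of "\<lambda>u. t l *\<^sub>R u"] arg_cong[OF t[of k l], of "\<lambda>u. s l *\<^sub>R u"]
    by (simp add: algebra_simps del: scaleR_cancel_right)
  have k: "(s k * t l - s l * t k) *\<^sub>R a k = 0"
    using arg_cong[OF s[of k l], of "\<lambda>u. t k *\<^sub>R u"] arg_cong[OF t[of k l], of "\<lambda>u. s k *\<^sub>R u"]
    by (simp add: algebra_simps del: scaleR_cancel_right)
  have "a k = 0" "a l = 0" using k l indep by auto
  moreover have "s k \<noteq> 0 \<or> s l \<noteq> 0" using indep by auto
  ultimately show ?thesis using s[of k i] s[of l i] by auto
qed

text \<open>The heart of the proof. Since \<open>(x, y) \<mapsto> f (x - y)\<close> vanishes when \<open>x\<close> or \<open>y\<close> moves on the level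
surface, the gradient of \<open>f\<close> at \<open>x - y\<close> is parallel to the normals at both points. These are
independent, so the gradient is zero. The partial derivatives of \<open>f\<close> are exponential sums
with the coefficients multiplied by \<open>- \<i> z\<^sub>j\<close>, and they satisfy the same hypothesis as
\<open>f\<close>. Hence the hypothesis is closed under multiplication of the coefficients by polynomials.\<close>

lemma exp_sum_zero_on_differences:
  fixes X :: "(int ^ 'n) set" and V :: "((real ^ 'n) \<times> (real ^ 'n)) set"
  assumes fin: "finite X" and V: "open V"
    and zero: "\<And>x y. (x, y) \<in> V \<Longrightarrow> phi_lift x = lam \<Longrightarrow> phi_lift y = lam \<Longrightarrow> exp_sum X w (x - y) = 0"
    and indep: "\<And>x y. (x, y) \<in> V \<Longrightarrow> sin (x $ k) * sin (y $ l) \<noteq> sin (x $ l) * sin (y $ k)"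
    and ne: "(x0, y0) \<in> V" "phi_lift x0 = lam" "phi_lift y0 = lam"
    and "z \<in> X"
  shows "w z = 0"
proof -
  define P where "P w \<longleftrightarrow> (\<forall>x y. (x, y) \<in> V \<longrightarrow> phi_lift x = lam \<longrightarrow> phi_lift y = lam \<longrightarrow>
      exp_sum X w (x - y) = 0)" for w
  have closed: "P (\<lambda>z. of_int (z $ j - c) * w z)" if w: "P w" for w j c
    unfolding P_def
  proof (intro allI impI)
    fix x y assume xy: "(x, y) \<in> V" and x: "phi_lift x = lam" and y: "phi_lift y = lam"
    let ?D = "\<lambda>h. exp_sum X (\<lambda>z. - \<i> * complex_of_real (h \<bullet> of_lattice z) * w z) (x - y)"
    define a where "a i = ?D (axis i 1)" for i
    have D: "(exp_sum X w has_derivative ?D) (at (x - y))"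
      by (rule exp_sum_has_derivative[OF fin])
    have evV: "\<forall>\<^sub>F p in nhds (x, y). p \<in> V" using V xy by (simp add: eventually_nhds_in_open)
    have "((\<lambda>x'. exp_sum X w (x' - y)) has_derivative ?D) (at x)"
    proof -
      have "((\<lambda>x'. x' - y) has_derivative (\<lambda>h. h)) (at x)"
        by (auto intro!: derivative_eq_intros)
      from has_derivative_compose[OF this D] show ?thesis .
    qed
    moreover have "\<forall>\<^sub>F x' in nhds x. phi_lift x' = phi_lift x \<longrightarrow> exp_sum X w (x' - y) = 0"
    proof -
      have "((\<lambda>x'. (x', y)) \<longlongrightarrow> (x, y)) (nhds x)" by (intro tendsto_Pair filterlim_ident tendsto_const)
      from filterlim_iff[THEN iffD1, OF this, rule_format, OF evV]
      show ?thesis by eventually_elim (use w x y in \<open>auto simp: P_def\<close>)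
    qed
    ultimately have sx: "sin (x $ i) *\<^sub>R a j = sin (x $ j) *\<^sub>R a i" for i j
      unfolding a_def by (rule level_surface_multiplier)
    have "((\<lambda>y'. exp_sum X w (x - y')) has_derivative (\<lambda>h. ?D (- h))) (at y)"
    proof -
      have "((\<lambda>y'. x - y') has_derivative (\<lambda>h. - h)) (at y)"
        by (auto intro!: derivative_eq_intros)
      from has_derivative_compose[OF this D] show ?thesis .
    qed
    moreover have "\<forall>\<^sub>F y' in nhds y. phi_lift y' = phi_lift y \<longrightarrow> exp_sum X w (x - y') = 0"
    proof -
      have "((\<lambda>y'. (x, y')) \<longlongrightarrow> (x, y)) (nhds y)" by (intro tendsto_Pair filterlim_ident tendsto_const)
      from filterlim_iff[THEN iffD1, OF this, rule_format, OF evV]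
      show ?thesis by eventually_elim (use w x y in \<open>auto simp: P_def\<close>)
    qed
    ultimately have mult: "sin (y $ i) *\<^sub>R ?D (- axis j 1) = sin (y $ j) *\<^sub>R ?D (- axis i 1)" for i j
      by (rule level_surface_multiplier)
    have "linear ?D" using D by (rule has_derivative_linear)
    then have neg: "?D (- h) = - ?D h" for h by (rule linear_neg)
    have sy: "sin (y $ i) *\<^sub>R a j = sin (y $ j) *\<^sub>R a i" for i j
      using mult[of i j] unfolding neg a_def[symmetric]
      by (simp only: scaleR_minus_right neg_equal_iff_equal)
    have "a j = 0"
      using parallel_to_independent_imp_zero[of "\<lambda>i. sin (x $ i)" a "\<lambda>i. sin (y $ i)" k l] sx sy indep[OF xy]
      by auto
    moreover have "a j = - \<i> * exp_sum X (\<lambda>z. of_int (z $ j) * w z) (x - y)"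
      by (simp only: a_def axis_inner_of_lattice mult.assoc exp_sum_scale of_real_of_int_eq)
    ultimately have "exp_sum X (\<lambda>z. of_int (z $ j) * w z) (x - y) = 0" by simp
    moreover have "exp_sum X w (x - y) = 0" using w xy x y by (auto simp: P_def)
    ultimately show "exp_sum X (\<lambda>z. of_int (z $ j - c) * w z) (x - y) = 0"
      by (simp add: left_diff_distrib exp_sum_diff exp_sum_scale)
  qed
  show ?thesis
  proof (rule exp_sum_coeffs_eq_zero[where P = P, OF fin _ closed])
    show "exp_sum X w (x0 - y0) = 0" if "P w" for w using that ne by (auto simp: P_def)
    show "P w" using zero by (auto simp: P_def)
  qed (use \<open>z \<in> X\<close> in auto)
qed


section \<open>Potentials and amplitudes\<close>

lemma finite_bounded_lattice:
  assumes "bounded D"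
  shows "finite {z :: int ^ 'n. of_lattice z \<in> D}"
proof -
  obtain R where R: "\<And>x. x \<in> D \<Longrightarrow> norm x \<le> R" using assms by (auto simp: bounded_iff)
  have "{z :: int ^ 'n. of_lattice z \<in> D} \<subseteq> vec_lambda ` (UNIV \<rightarrow>\<^sub>E {- \<lceil>R\<rceil>..\<lceil>R\<rceil>})"
  proof
    fix z :: "int ^ 'n" assume "z \<in> {z. of_lattice z \<in> D}"
    then have "norm (of_lattice z) \<le> R" using R by auto
    then have "\<bar>real_of_int (z $ i)\<bar> \<le> R" for i
      using component_le_norm_cart[of "of_lattice z" i] by (simp add: of_lattice_def)
    then have "z $ i \<in> {- \<lceil>R\<rceil>..\<lceil>R\<rceil>}" for i
      by (smt (verit) atLeastAtMost_iff le_ceiling_iff le_of_int_ceiling of_int_le_iff of_int_minus)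
    then have "vec_nth z \<in> (UNIV \<rightarrow>\<^sub>E {- \<lceil>R\<rceil>..\<lceil>R\<rceil>})" by auto
    then show "z \<in> vec_lambda ` (UNIV \<rightarrow>\<^sub>E {- \<lceil>R\<rceil>..\<lceil>R\<rceil>})" by (metis image_eqI vec_nth_inverse)
  qed
  then show ?thesis by (rule finite_subset) (auto intro!: finite_PiE)
qed

lemma fourier_eq_exp_sum:
  assumes "finite X" "\<And>z. z \<notin> X \<Longrightarrow> v z = 0"
  shows "fourier v (to_torus p) = complex_of_real ((2 * pi) powr (- real CARD('n::finite) / 2)) * exp_sum X v (p :: real ^ 'n)"
proof -
  have "(\<Sum>\<^sub>\<infinity>z\<in>UNIV. v z * exp (- \<i> * complex_of_real (p \<bullet> of_lattice z))) =
      (\<Sum>\<^sub>\<infinity>z\<in>X. v z * exp (- \<i> * complex_of_real (p \<bullet> of_lattice z)))"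
    using assms by (intro infsum_cong_neutral) auto
  then show ?thesis using assms by (simp add: fourier.abs_eq exp_sum_def)
qed

text \<open>The inverse Gauss map takes the direction of the gradient at \<open>x\<close> to \<open>x\<close>, hence the opposite
direction, where the denominator is evaluated, to the reflected point \<open>- x\<close>. There
the curvature and the gradient do not vanish, and the factors of the amplitude can be cancelled.\<close>

lemma born_amplitude_determines_fourier:
  fixes x :: "real ^ 'n"
  assumes card: "CARD('n) \<ge> 2" and x: "x \<in> shell lam"
    and eq: "born_amplitude lam v1 k (- unit_normal phi_lift x) = born_amplitude lam v2 k (- unit_normal phi_lift x)"
  shows "fourier v1 (to_torus x - k) = fourier v2 (to_torus x - k)"
proof -
  have k1: "kappa (- (- unit_normal phi_lift x)) lam = to_torus x"
    using kappa_unit_normal[OF card x] by simp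
  have mx: "- x \<in> shell lam" using x by (rule shell_uminus)
  have k2: "kappa (- unit_normal phi_lift x) lam = to_torus (- x)"
    using kappa_unit_normal[OF card mx] by (simp add: unit_normal_uminus)
  have "gauss_curvature (- unit_normal phi_lift x) lam \<noteq> 0"
    using shell_total_curvature_nonzero[OF card mx]
    by (simp add: gauss_curvature_def k2 curvature_phi.abs_eq)
  moreover have "norm (grad_phi (kappa (- unit_normal phi_lift x) lam)) \<noteq> 0"
    using shell_grad_nonzero[OF card mx] by (simp add: k2 grad_phi.abs_eq)
  ultimately have "complex_of_real (sqrt \<bar>gauss_curvature (- unit_normal phi_lift x) lam\<bar> *
      norm (grad_phi (kappa (- unit_normal phi_lift x) lam))) \<noteq> 0" by simp
  moreover have "complex_of_real (sqrt (2 * pi)) \<noteq> 0" by simp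
  moreover have "f = g" if "- (a * f * exp b) / c = - (a * g * exp b) / c" "c \<noteq> 0" "a \<noteq> 0"
    for a b c f g :: complex
    using that by simp
  ultimately show ?thesis
    using eq unfolding born_amplitude_def k1 by blast
qed


section \<open>Uniqueness for the Born inverse problem\<close>

theorem theoremA4:
  fixes lam :: real
    and D :: "(real ^ 'n) set"
    and v1 v2 :: "int ^ 'n \<Rightarrow> complex"
    and N :: "('n torus \<times> (real ^ 'n)) set"
    and k :: "'n torus" and \<omega> :: "real ^ 'n"
  assumes "CARD('n) \<ge> 2"
    and "2 * real CARD('n) - 4 < \<bar>lam\<bar>" and "\<bar>lam\<bar> < 2 * real CARD('n)"
    and "open D" and "connected D" and "bounded D"
    and "D \<inter> range of_lattice \<noteq> {}"
    and "of_lattice ` {x. v1 x \<noteq> 0} \<subseteq> D" and "of_lattice ` {x. v2 x \<noteq> 0} \<subseteq> D"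
    and "k \<in> level_surface lam" and "\<omega> \<in> sphere 0 1"
    and "openin (top_of_set (level_surface lam \<times> sphere 0 1)) N" and "(k, \<omega>) \<in> N"
    and "\<forall>(k', \<omega>') \<in> N. born_amplitude lam v1 k' \<omega>' = born_amplitude lam v2 k' \<omega>'"
  shows "v1 = v2"
proof -
  note card = assms(1)
  define X where "X = {z :: int ^ 'n. of_lattice z \<in> D}"
  have X: "finite X" unfolding X_def using \<open>bounded D\<close> by (rule finite_bounded_lattice)
  have v: "v1 z = 0" "v2 z = 0" if "z \<notin> X" for z using that assms(8,9) by (auto simp: X_def)
  obtain W where W: "open W" "N = (level_surface lam \<times> sphere 0 1) \<inter> W"
    using assms(12) by (auto simp: openin_open)
  then have "(k, \<omega>) \<in> W" using assms(13) by auto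
  with \<open>open W\<close> obtain A \<Omega> where A: "open A" "k \<in> A" and \<Omega>: "open \<Omega>" "\<omega> \<in> \<Omega>" and sub: "A \<times> \<Omega> \<subseteq> W"
    by (auto elim!: open_prod_elim)
  obtain y0 where y0: "k = to_torus y0" by (metis Quotient_abs_rep Quotient_torus)
  have y0s: "y0 \<in> shell lam"
    using assms(2,3,10) by (simp add: y0 shell_def level_surface_def phi.abs_eq)
  obtain x0 where x0: "x0 \<in> shell lam" "unit_normal phi_lift x0 = - \<omega>"
    using shell_gauss_map_surj[OF card assms(2,3), of "- \<omega>"] assms(11) by auto
  define B where "B = to_torus -` A"
  have B: "open B" "y0 \<in> B" using A by (auto simp: B_def open_torus_def y0)
  define E where "E = {x. grad phi_lift x \<noteq> 0} \<inter> (\<lambda>x. - unit_normal phi_lift x) -` \<Omega>"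
  have cg: "continuous_on Z (grad phi_lift)" for Z :: "(real ^ 'n) set"
    unfolding grad_phi_lift[abs_def] by (intro continuous_intros)
  have "open {x :: real ^ 'n. grad phi_lift x \<noteq> 0}"
    by (intro open_Collect_neq cg continuous_on_const)
  moreover have "continuous_on {x :: real ^ 'n. grad phi_lift x \<noteq> 0} (\<lambda>x. - unit_normal phi_lift x)"
    unfolding unit_normal_def by (intro continuous_intros cg) auto
  ultimately have "open E"
    unfolding E_def using \<Omega> continuous_on_open_vimage[of "{x :: real ^ 'n. grad phi_lift x \<noteq> 0}"]
    by (metis Int_commute)
  have "x0 \<in> E" using x0 \<Omega> shell_grad_nonzero[OF card x0(1)] by (simp add: E_def)
  obtain y1 i j where y1: "y1 \<in> shell lam" "y1 \<in> B" "sin (x0 $ i) * sin (y1 $ j) \<noteq> sin (x0 $ j) * sin (y1 $ i)"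
    using shell_nonparallel[OF card x0(1) y0s B] by blast
  define V where "V = (E \<times> B) \<inter> {(x, y). sin (x $ i) * sin (y $ j) \<noteq> sin (x $ j) * sin (y $ i)}"
  have "open {p :: (real ^ 'n) \<times> (real ^ 'n).
      sin (fst p $ i) * sin (snd p $ j) \<noteq> sin (fst p $ j) * sin (snd p $ i)}"
    by (intro open_Collect_neq continuous_intros)
  then have V: "open V"
    unfolding V_def case_prod_unfold using \<open>open E\<close> B by (intro open_Int open_Times)
  \<comment> \<open>The pairs are parametrised by points \<open>x\<close> of the surface rather than by directions, with
    \<open>- unit_normal phi_lift x\<close> as the direction, so that nothing about the regularity of \<open>kappa\<close> enters.\<close>
  have eq: "v1 z - v2 z = 0" if "z \<in> X" for z
  proof (rule exp_sum_zero_on_differences[where w = "\<lambda>z. v1 z - v2 z", OF X V])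
    fix x y assume xy: "(x, y) \<in> V" "phi_lift x = lam" "phi_lift y = lam"
    then have x: "x \<in> shell lam" using assms(2,3) by (simp add: shell_def)
    have "norm (unit_normal phi_lift x) = 1"
      using shell_grad_nonzero[OF card x] by (simp add: unit_normal_def)
    then have "(to_torus y, - unit_normal phi_lift x) \<in> N"
      using xy sub unfolding W by (auto simp: V_def E_def B_def level_surface_def phi.abs_eq)
    then have "fourier v1 (to_torus x - to_torus y) = fourier v2 (to_torus x - to_torus y)"
      using assms(14) by (intro born_amplitude_determines_fourier[OF card x]) auto
    then have "exp_sum X v1 (x - y) = exp_sum X v2 (x - y)"
      using v by (simp add: minus_torus.abs_eq fourier_eq_exp_sum[OF X])
    then show "exp_sum X (\<lambda>z. v1 z - v2 z) (x - y) = 0" by (simp add: exp_sum_diff)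
  next
    show "(x0, y1) \<in> V" using \<open>x0 \<in> E\<close> y1 by (simp add: V_def)
    show "phi_lift x0 = lam" "phi_lift y1 = lam" using x0 y1 by (auto simp: shell_def)
  qed (use that in \<open>auto simp: V_def\<close>)
  show ?thesis
  proof (rule ext)
    show "v1 z = v2 z" for z using eq[of z] v[of z] by (cases "z \<in> X") auto
  qed
qed

end
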